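(* Let $\mathcal{A}$ be a finite primal algebra (with finite signature) of order $n\geq 2$. Then $$\mathrm{PSpec}(\mathcal{A})=\left\{\frac{r}{n^k}\;\middle|\; k\geq 0,\ 0\leq r\leq n^k,\ r,k\in\mathbb{Z}\right\},$$ that is, the spectrum of $\mathcal{A}$ is the set of $n$-adic numbers in the interval $[0,1]$.
   Context: All algebras are (nonempty) algebras in the sense of universal algebra, finite and with a finite signature; the order of an algebra is the cardinality of its universe $A$, and it is non-trivial if it has at least two elements. A term is an element of the absolutely free algebra over an infinite set of variables; a term with $k$ variables is interpreted in $\mathcal{A}$ as a function $A^k\to A$. An equation $t\approx t'$ is an ordered pair of terms in the signature; its number of variables $k$ is the total number of distinct variables appearing in it. The probability of the equation over $\mathcal{A}$ is $$\Pr(t\approx t'\mid\mathcal{A})=\frac{|\{\vec{x}\in A^k\mid t(\vec{x})=t'(\vec{x})\}|}{|A|^k},$$ and $\mathrm{PSpec}(\mathcal{A})=\{\Pr(t\approx t'\mid\mathcal{A})\mid t\approx t' \text{ an equation in the signature of }\mathcal{A}\}$. An algebra is primal if every operation $A^k\to A$ of positive arity $k$ is (the interpretation of) a term of the algebra. An $n$-adic number in $[0,1]$ means a number of the form $r/n^k$ with integers $k\geq 0$ and $0\leq r\leq n^k$. *)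

theory Defs
  imports Complex_Main "HOL-Library.FuncSet"
begin

record ('f, 'a) alg =
  symbols :: "'f set"
  arity :: "'f \<Rightarrow> nat"
  univ :: "'a set"
  oper :: "'f \<Rightarrow> 'a list \<Rightarrow> 'a"

text \<open>The arity of a symbol may be 0, and \<open>oper\<close> only matters on symbols of the signature
  applied to lists of the right length over the universe.\<close>

definition algebra :: "('f, 'a) alg \<Rightarrow> bool" where
  "algebra \<A> \<longleftrightarrow> univ \<A> \<noteq> {} \<and>
     (\<forall>f\<in>symbols \<A>. \<forall>as. length as = arity \<A> f \<longrightarrow> set as \<subseteq> univ \<A> \<longrightarrow>
        oper \<A> f as \<in> univ \<A>)"

definition finite_algebra :: "('f, 'a) alg \<Rightarrow> bool" where
  "finite_algebra \<A> \<longleftrightarrow> algebra \<A> \<and> finite (symbols \<A>) \<and> finite (univ \<A>)"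

datatype 'f tm = Var nat | Op 'f "'f tm list"

primrec vars :: "'f tm \<Rightarrow> nat set" where
  "vars (Var i) = {i}"
| "vars (Op f ts) = (\<Union>V\<in>set (map vars ts). V)"

primrec eval :: "('f, 'a) alg \<Rightarrow> (nat \<Rightarrow> 'a) \<Rightarrow> 'f tm \<Rightarrow> 'a" where
  "eval \<A> x (Var i) = x i"
| "eval \<A> x (Op f ts) = oper \<A> f (map (eval \<A> x) ts)"

inductive_set terms :: "('f, 'a) alg \<Rightarrow> 'f tm set" for \<A> where
  Var: "Var i \<in> terms \<A>"
| Op: "f \<in> symbols \<A> \<Longrightarrow> length ts = arity \<A> f \<Longrightarrow> (\<And>t. t \<in> set ts \<Longrightarrow> t \<in> terms \<A>)
       \<Longrightarrow> Op f ts \<in> terms \<A>"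

text \<open>Tuples over the universe indexed by a set of variables; \<open>tuples \<A> {..<k}\<close> is the
  \<open>k\<close>-th Cartesian power of the universe.\<close>

definition tuples :: "('f, 'a) alg \<Rightarrow> nat set \<Rightarrow> (nat \<Rightarrow> 'a) set" where
  "tuples \<A> V = (\<Pi>\<^sub>E i\<in>V. univ \<A>)"

definition equations :: "('f, 'a) alg \<Rightarrow> ('f tm \<times> 'f tm) set" where
  "equations \<A> = terms \<A> \<times> terms \<A>"

text \<open>The tuples range over the variables that actually occur in the equation.\<close>

definition Pr :: "('f, 'a) alg \<Rightarrow> 'f tm \<times> 'f tm \<Rightarrow> real" where
  "Pr \<A> e = (case e of (t, t') \<Rightarrow>
     real (card {x \<in> tuples \<A> (vars t \<union> vars t'). eval \<A> x t = eval \<A> x t'})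
       / real (card (univ \<A>)) ^ card (vars t \<union> vars t'))"

definition PSpec :: "('f, 'a) alg \<Rightarrow> real set" where
  "PSpec \<A> = {Pr \<A> e | e. e \<in> equations \<A>}"

text \<open>A term representing a \<open>k\<close>-ary operation may use any subset of the first \<open>k\<close> variables,
  so projections and constant operations are covered in the usual way.\<close>

definition primal :: "('f, 'a) alg \<Rightarrow> bool" where
  "primal \<A> \<longleftrightarrow> (\<forall>k\<ge>1. \<forall>g \<in> tuples \<A> {..<k} \<rightarrow> univ \<A>.
     \<exists>t\<in>terms \<A>. vars t \<subseteq> {..<k} \<and> (\<forall>x\<in>tuples \<A> {..<k}. eval \<A> x t = g x))"

end

theory Submission imports Defs begin

text \<open>
  A probability over an algebra of order \<open>n\<close> is a count of at most \<open>n ^ k\<close> tuples divided by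
  \<open>n ^ k\<close>, hence an \<open>n\<close>-adic number in the unit interval. For the converse, write a given
  \<open>n\<close>-adic number as \<open>r / n ^ k\<close> with \<open>k \<ge> 1\<close>, pick a set \<open>R\<close> of \<open>r\<close> tuples in the \<open>k\<close>-th power
  of the universe, and let \<open>g\<close> agree with the first projection exactly on \<open>R\<close>; such a \<open>g\<close> exists
  because there are at least two elements to choose values from. Primality gives a term \<open>t\<close>
  that represents \<open>g\<close>, and the equation between \<open>t\<close> and the first variable holds exactly on \<open>R\<close>.

  The one delicate point is that \<open>t\<close> need not mention all of the first \<open>k\<close> variables, whereas the
  probability of an equation is measured over the tuples of the variables that do occur. Padding
  by dummy variables multiplies the number of solutions and the number of all tuples by the same
  power of \<open>n\<close>, so the probability may be computed over any larger finite set of variables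
  (lemma \<open>Pr_over_superset\<close>).
\<close>

lemma finite_vars: "finite (vars t)"
  by (induction t) auto

lemma card_tuples:
  assumes "finite V"
  shows "card (tuples \<A> V) = card (univ \<A>) ^ card V"
  using assms by (simp add: tuples_def card_PiE)

lemma finite_tuples:
  assumes "finite V" "finite (univ \<A>)"
  shows "finite (tuples \<A> V)"
  using assms by (simp add: tuples_def finite_PiE)

lemma eval_cong:
  assumes "\<And>i. i \<in> vars t \<Longrightarrow> x i = y i"
  shows "eval \<A> x t = eval \<A> y t"
  using assms
proof (induction t)
  case (Op f ts)
  have "eval \<A> x s = eval \<A> y s" if "s \<in> set ts" for s
    using that by (intro Op.IH) (auto intro!: Op.prems)
  then have "map (eval \<A> x) ts = map (eval \<A> y) ts"
    by simp
  then show ?case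
    by (simp only: eval.simps)
qed simp

text \<open>A tuple over \<open>W\<close> is a pair of a tuple over \<open>V\<close> and one over \<open>W - V\<close>, so a condition that
  depends only on the coordinates in \<open>V\<close> defines a cylinder over its solutions in these
  coordinates.\<close>

lemma card_cylinder:
  assumes "finite W" "V \<subseteq> W"
  shows "card {x \<in> tuples \<A> W. P (restrict x V)}
       = card {x \<in> tuples \<A> V. P x} * card (univ \<A>) ^ card (W - V)"
proof -
  have "bij_betw (\<lambda>x. (restrict x V, restrict x (W - V)))
          {x \<in> tuples \<A> W. P (restrict x V)} ({x \<in> tuples \<A> V. P x} \<times> tuples \<A> (W - V))"
  proof (rule bij_betw_byWitness[where f' = "\<lambda>(y, z) i. if i \<in> V then y i else z i"])
    show "\<forall>x\<in>{x \<in> tuples \<A> W. P (restrict x V)}.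
        (case (restrict x V, restrict x (W - V)) of (y, z) \<Rightarrow> \<lambda>i. if i \<in> V then y i else z i) = x"
      using assms(2) by (auto simp: tuples_def fun_eq_iff PiE_def extensional_def)
    have split: "restrict (\<lambda>i. if i \<in> V then y i else z i) V = y"
      "restrict (\<lambda>i. if i \<in> V then y i else z i) (W - V) = z"
      if "y \<in> tuples \<A> V" "z \<in> tuples \<A> (W - V)" for y z
      using that by (auto simp: tuples_def fun_eq_iff PiE_def extensional_def)
    then show "\<forall>p\<in>{x \<in> tuples \<A> V. P x} \<times> tuples \<A> (W - V).
        (restrict (case p of (y, z) \<Rightarrow> \<lambda>i. if i \<in> V then y i else z i) V,
         restrict (case p of (y, z) \<Rightarrow> \<lambda>i. if i \<in> V then y i else z i) (W - V)) = p"
      by auto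
    show "(\<lambda>x. (restrict x V, restrict x (W - V))) ` {x \<in> tuples \<A> W. P (restrict x V)}
        \<subseteq> {x \<in> tuples \<A> V. P x} \<times> tuples \<A> (W - V)"
      using assms(2) by (auto simp: tuples_def)
    have "(\<lambda>i. if i \<in> V then y i else z i) \<in> tuples \<A> W"
      if "y \<in> tuples \<A> V" "z \<in> tuples \<A> (W - V)" for y z
      using that assms(2) by (auto simp: tuples_def PiE_def extensional_def Pi_def)
    with split show "(\<lambda>(y, z) i. if i \<in> V then y i else z i) `
        ({x \<in> tuples \<A> V. P x} \<times> tuples \<A> (W - V)) \<subseteq> {x \<in> tuples \<A> W. P (restrict x V)}"
      by auto
  qed
  then have "card {x \<in> tuples \<A> W. P (restrict x V)}
      = card ({x \<in> tuples \<A> V. P x} \<times> tuples \<A> (W - V))"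
    by (rule bij_betw_same_card)
  then show ?thesis
    using assms(1) by (simp add: card_cartesian_product card_tuples)
qed

lemma Pr_over_superset:
  assumes "finite W" "vars t \<union> vars t' \<subseteq> W" and pos: "card (univ \<A>) > 0"
  shows "Pr \<A> (t, t') = real (card {x \<in> tuples \<A> W. eval \<A> x t = eval \<A> x t'})
                          / real (card (univ \<A>)) ^ card W"
proof -
  let ?V = "vars t \<union> vars t'" and ?n = "card (univ \<A>)"
  have "eval \<A> (restrict x ?V) t = eval \<A> x t" "eval \<A> (restrict x ?V) t' = eval \<A> x t'" for x
    by (auto intro!: eval_cong)
  then have "card {x \<in> tuples \<A> W. eval \<A> x t = eval \<A> x t'}
      = card {x \<in> tuples \<A> ?V. eval \<A> x t = eval \<A> x t'} * ?n ^ card (W - ?V)"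
    using card_cylinder[OF assms(1,2), of \<A> "\<lambda>x. eval \<A> x t = eval \<A> x t'"] by simp
  moreover have "card W = card ?V + card (W - ?V)"
    using assms(1,2) by (metis card_Diff_subset card_mono finite_subset le_add_diff_inverse)
  ultimately show ?thesis
    using pos by (simp add: Pr_def power_add)
qed

lemma Pr_n_adic:
  assumes "finite (univ \<A>)"
  obtains r k where "r \<le> card (univ \<A>) ^ k" "Pr \<A> e = real r / real (card (univ \<A>)) ^ k"
proof -
  obtain t t' where e: "e = (t, t')"
    by (cases e)
  let ?V = "vars t \<union> vars t'"
  have fin: "finite ?V"
    by (simp add: finite_vars)
  have "card {x \<in> tuples \<A> ?V. eval \<A> x t = eval \<A> x t'} \<le> card (tuples \<A> ?V)"
    by (rule card_mono) (auto simp: finite_tuples[OF fin assms])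
  then show thesis
    by (intro that) (auto simp: card_tuples[OF fin] e Pr_def)
qed

lemma primal_Pr_attained:
  assumes "primal \<A>" "card (univ \<A>) \<ge> 2" "k \<ge> 1" "r \<le> card (univ \<A>) ^ k"
  shows "real r / real (card (univ \<A>)) ^ k \<in> PSpec \<A>"
proof -
  let ?T = "tuples \<A> {..<k}"
  obtain R where R: "R \<subseteq> ?T" "card R = r"
    using obtain_subset_with_card_n[of r ?T] assms(4) by (auto simp: card_tuples)
  have "\<exists>b\<in>univ \<A>. b \<noteq> a" for a
  proof (rule ccontr)
    assume "\<not> (\<exists>b\<in>univ \<A>. b \<noteq> a)"
    then have "card (univ \<A>) \<le> card {a}"
      by (intro card_mono) auto
    with assms(2) show False
      by simp
  qed
  then obtain other where other: "\<And>a. other a \<in> univ \<A>" "\<And>a. other a \<noteq> a"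
    by metis
  define g where "g x = (if x \<in> R then x 0 else other (x 0))" for x
  have "g \<in> ?T \<rightarrow> univ \<A>"
    using assms(3) other by (auto simp: g_def tuples_def PiE_def Pi_def)
  then obtain t where t: "t \<in> terms \<A>" "vars t \<subseteq> {..<k}" "\<forall>x\<in>?T. eval \<A> x t = g x"
    using assms(1,3) unfolding primal_def by blast
  have "{x \<in> ?T. eval \<A> x t = eval \<A> x (Var 0)} = R"
    using t(3) R(1) other by (auto simp: g_def split: if_splits)
  then have "Pr \<A> (t, Var 0) = real r / real (card (univ \<A>)) ^ k"
    using Pr_over_superset[of "{..<k}" t "Var 0" \<A>] t(2) R(2) assms(2,3) by auto
  moreover have "(t, Var 0) \<in> equations \<A>"
    using t(1) by (simp add: equations_def terms.Var)
  ultimately show ?thesis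
    unfolding PSpec_def by (metis (mono_tags, lifting) mem_Collect_eq)
qed

theorem theorem4p3:
  fixes \<A> :: "('f, 'a) alg" and n :: nat
  assumes "finite_algebra \<A>" and "primal \<A>"
    and "n = card (univ \<A>)" and "n \<ge> 2"
  shows "PSpec \<A> = {real r / real n ^ k | (r::nat) (k::nat). r \<le> n ^ k}"
proof (intro equalityI subsetI)
  fix p
  assume "p \<in> PSpec \<A>"
  then obtain e where "p = Pr \<A> e"
    by (auto simp: PSpec_def)
  moreover have "finite (univ \<A>)"
    using assms(1) by (simp add: finite_algebra_def)
  ultimately show "p \<in> {real r / real n ^ k | (r::nat) (k::nat). r \<le> n ^ k}"
    using Pr_n_adic[of \<A> e] assms(3) by blast
next
  fix p
  assume "p \<in> {real r / real n ^ k | (r::nat) (k::nat). r \<le> n ^ k}"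
  then obtain r k where rk: "r \<le> n ^ k" "p = real r / real n ^ k"
    by auto
  \<comment> \<open>Primality speaks of positive arities only; expanding the fraction by \<open>n\<close> also covers
    \<open>k = 0\<close>.\<close>
  have "r * n \<le> n ^ Suc k"
    using rk(1) by simp
  then have "real (r * n) / real n ^ Suc k \<in> PSpec \<A>"
    using primal_Pr_attained[of \<A> "Suc k" "r * n"] assms by simp
  then show "p \<in> PSpec \<A>"
    using rk(2) assms(4) by simp
qed

end
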